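(* Let $X$ be a compact metric space, let $f\subset X\times X$ be a closed relation, and let $B\subset X$ be an attractor block for $f$. Then there exists $\epsilon>0$ such that for every closed relation $g\subset X\times X$ with $g\subset\overline{N}_\epsilon(f)$, $B$ is also an attractor block for $g$.
   Context: A closed relation on $X$ is a closed subset $f\subset X\times X$; for $S\subset X$, $f(S)=\{y\in X:\exists x\in S,\ (x,y)\in f\}$. A set $B\subset X$ is an attractor block for $f$ if $f(\overline B)\subset\operatorname{int}(B)$. The product $X\times X$ carries the metric $d((x,y),(x',y'))=\sqrt{d(x,x')^2+d(y,y')^2}$, and $\overline N_\epsilon(f)\subset X\times X$ denotes the closed $\epsilon$-neighborhood of $f$ (the set of points at distance at most $\epsilon$ from $f$; empty if $f$ is empty). *)

theory Defs
  imports "HOL-Analysis.Analysis"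
begin

text \<open>
  The space is a subset \<open>X\<close> of a metric type, with the restricted metric and the subspace
  topology \<open>top_of_set X\<close>; closed sets, closures and interiors are all relative to \<open>X\<close>
  (respectively \<open>X \<times> X\<close>). A carrier set is used, rather than the whole type, so that
  \<open>X\<close> may be empty.
\<close>

definition closed_relation :: "'a::metric_space set \<Rightarrow> ('a \<times> 'a) set \<Rightarrow> bool" where
  "closed_relation X f \<longleftrightarrow> closedin (top_of_set (X \<times> X)) f"

text \<open>The image of \<open>S\<close> under the relation \<open>f\<close> is the library's \<open>f `` S\<close>.\<close>

definition attractor_block :: "'a::metric_space set \<Rightarrow> ('a \<times> 'a) set \<Rightarrow> 'a set \<Rightarrow> bool" where
  "attractor_block X f B \<longleftrightarrow>
     B \<subseteq> X \<and> f `` (top_of_set X closure_of B) \<subseteq> top_of_set X interior_of B"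

text \<open>
  The library's distance on pairs is the required one,
  \<open>sqrt ((dist x x')\<^sup>2 + (dist y y')\<^sup>2)\<close> (see \<open>dist_Pair_Pair\<close>). Since \<open>infdist p {} = 0\<close>,
  the condition \<open>f \<noteq> {}\<close> is needed to make the neighborhood of the empty relation empty.
\<close>

definition closed_nbhd :: "'a::metric_space set \<Rightarrow> real \<Rightarrow> ('a \<times> 'a) set \<Rightarrow> ('a \<times> 'a) set" where
  "closed_nbhd X \<epsilon> f = {p \<in> X \<times> X. f \<noteq> {} \<and> infdist p f \<le> \<epsilon>}"

end

theory Submission
  imports Defs
begin

text \<open>
  The block condition says that \<open>f\<close> misses the set of pairs in \<open>closure B \<times> (X - interior B)\<close>.
  Both are compact. If \<open>f\<close> is nonempty, they are at distance at least some \<open>d > 0\<close>, and \<open>\<epsilon> = d / 2\<close> works.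
\<close>

text \<open>The distance to \<open>F\<close> is continuous, so on a nonempty compact
  \<open>K\<close> it attains its minimum, which is positive because the minimizer lies outside the
  closed set \<open>F\<close>. Nonemptiness of \<open>F\<close> matters since
  \<open>infdist p {} = 0\<close>.\<close>

lemma compact_infdist_bounded_below:
  fixes K F :: "'a::metric_space set"
  assumes "compact K" "closed F" "F \<noteq> {}" "K \<inter> F = {}"
  obtains d where "d > 0" "\<And>p. p \<in> K \<Longrightarrow> d \<le> infdist p F"
proof (cases "K = {}")
  case True
  then show ?thesis
    using that[of 1] by simp
next
  case False
  have "continuous_on K (\<lambda>p. infdist p F)"
    by (intro continuous_intros)
  then obtain p where p: "p \<in> K" "\<And>q. q \<in> K \<Longrightarrow> infdist p F \<le> infdist q F"
    using continuous_attains_inf[OF assms(1) False] by blast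
  moreover have "p \<notin> F"
    using p(1) assms(4) by blast
  then have "infdist p F > 0"
    using infdist_pos_not_in_closed[OF assms(2,3)] by blast
  ultimately show ?thesis
    using that by blast
qed

theorem theorem6p1:
  fixes X :: "'a::metric_space set" and f :: "('a \<times> 'a) set" and B :: "'a set"
  assumes "compact X"
    and "closed_relation X f"
    and "attractor_block X f B"
  shows "\<exists>\<epsilon>>0. \<forall>g. closed_relation X g \<and> g \<subseteq> closed_nbhd X \<epsilon> f \<longrightarrow> attractor_block X g B"
proof -
  let ?C = "top_of_set X closure_of B" and ?I = "top_of_set X interior_of B"
  define K where "K = ?C \<times> (X - ?I)"
  have "compact ?C"
    using closedin_compact[OF assms(1) closedin_closure_of] .
  moreover have "closedin (top_of_set X) (X - ?I)"
    using closedin_diff[OF closedin_topspace openin_interior_of, of "top_of_set X" B] by simp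
  then have "compact (X - ?I)"
    using closedin_compact[OF assms(1)] by blast
  ultimately have "compact K"
    unfolding K_def by (rule compact_Times)
  moreover have "compact f"
    using closedin_compact[OF compact_Times[OF assms(1) assms(1)]] assms(2)
    unfolding closed_relation_def by blast
  moreover have "K \<inter> f = {}"
    using assms(3) unfolding attractor_block_def K_def by blast
  \<comment> \<open>The guard \<open>f \<noteq> {}\<close> inside the bound lets one statement cover
    both cases: for empty \<open>f\<close> the bound is vacuous and \<open>d = 1\<close>
    serves.\<close>
  ultimately obtain d where d: "d > 0" "\<And>p. f \<noteq> {} \<Longrightarrow> p \<in> K \<Longrightarrow> d \<le> infdist p f"
    using compact_infdist_bounded_below[of K f] compact_imp_closed[of f] zero_less_one by metis
  \<comment> \<open>The neighborhood is closed and \<open>d\<close> may be attained on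
    \<open>K\<close>, so the radius has to be strictly below \<open>d\<close>.\<close>
  have "attractor_block X g B" if "g \<subseteq> closed_nbhd X (d / 2) f" for g
  proof -
    have "g `` ?C \<subseteq> ?I"
    proof (rule subsetI, rule ccontr)
      fix y assume "y \<in> g `` ?C" and "y \<notin> ?I"
      then obtain x where "x \<in> ?C" "(x, y) \<in> g"
        by blast
      \<comment> \<open>Membership of \<open>(x, y)\<close> in the neighborhood forces
        \<open>f \<noteq> {}\<close>, which releases the guarded bound on \<open>K\<close>.\<close>
      with that have "y \<in> X" "f \<noteq> {}" and le: "infdist (x, y) f \<le> d / 2"
        unfolding closed_nbhd_def by auto
      then have "(x, y) \<in> K"
        using \<open>x \<in> ?C\<close> \<open>y \<notin> ?I\<close> unfolding K_def by blast
      then have "d \<le> infdist (x, y) f"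
        using d(2) \<open>f \<noteq> {}\<close> by blast
      with le d(1) show False
        by simp
    qed
    then show ?thesis
      using assms(3) unfolding attractor_block_def by blast
  qed
  then show ?thesis
    using d(1) by (intro exI[of _ "d / 2"]) auto
qed

end
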